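(* There exist 2-connected planar graphs $G$ with maximum degree $5$ and $\chi_{\mathrm{os}}(G)=8$.
   Context: Graphs are finite, simple and undirected. For a vertex $v$ of a graph $G$, $N(v)=\{x: vx\in E(G)\}$ and $N[v]=N(v)\cup\{v\}$. A coloring of $G$ is a map $f:V(G)\to\mathbb{Z}^+$ (positive integers) such that $f(v)\ne f(w)$ for all $vw\in E(G)$. A coloring $f$ is an odd-sum coloring if $\sum_{w\in N[v]}f(w)$ is odd for each vertex $v\in V(G)$. The odd-sum chromatic number $\chi_{\mathrm{os}}(G)$ is the minimum size of the range of an odd-sum coloring of $G$ (it is known that every finite graph has an odd-sum coloring). *)

theory Defs
  imports "HOL-Analysis.Analysis" "Graph_Theory.Digraph_Component"
begin

text \<open>
  A finite simple undirected graph is a term satisfying \<^locale>\<open>pair_graph\<close>: a finite, loop-free,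
  symmetric digraph whose arcs are pairs of vertices, an edge \<open>uv\<close> being present as the two
  arcs \<open>(u,v)\<close> and \<open>(v,u)\<close>. The definitions below are meant for such graphs.
\<close>

definition nbhd :: "'a pair_pre_digraph \<Rightarrow> 'a \<Rightarrow> 'a set" where
  "nbhd G v = {x. (v, x) \<in> parcs G}"

definition closed_nbhd :: "'a pair_pre_digraph \<Rightarrow> 'a \<Rightarrow> 'a set" where
  "closed_nbhd G v = nbhd G v \<union> {v}"

definition max_degree :: "'a pair_pre_digraph \<Rightarrow> nat" where
  "max_degree G = Max ((\<lambda>v. card (nbhd G v)) ` pverts G)"

text \<open>
  The constant \<open>Digraph_Component.connected\<close> is graph connectedness (it excludes the empty graph);
  unqualified, the name could also mean the topological notion.
\<close>

definition k_connected :: "nat \<Rightarrow> 'a pair_pre_digraph \<Rightarrow> bool" where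
  "k_connected k G \<longleftrightarrow> card (pverts G) > k \<and>
     (\<forall>X \<subseteq> pverts G. card X < k \<longrightarrow>
        Digraph_Component.connected (with_proj G \<restriction> (pverts G - X)))"

text \<open>
  A drawing places the vertices at distinct points of the plane and draws the edge \<open>uv\<close> as an arc
  (a simple, not necessarily straight curve), the same for both orientations of the edge. The
  interior of an edge meets neither a vertex nor a different edge.
\<close>

definition plane_drawing ::
  "'a pair_pre_digraph \<Rightarrow> ('a \<Rightarrow> complex) \<Rightarrow> ('a \<Rightarrow> 'a \<Rightarrow> real \<Rightarrow> complex) \<Rightarrow> bool" where
  "plane_drawing G pos \<gamma> \<longleftrightarrow>
     inj_on pos (pverts G) \<and>
     (\<forall>(u, v) \<in> parcs G.
        Path_Connected.arc (\<gamma> u v) \<and> pathstart (\<gamma> u v) = pos u \<and> pathfinish (\<gamma> u v) = pos v \<and>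
        path_image (\<gamma> v u) = path_image (\<gamma> u v) \<and>
        \<gamma> u v ` {0<..<1} \<inter> pos ` pverts G = {}) \<and>
     (\<forall>(u, v) \<in> parcs G. \<forall>(x, y) \<in> parcs G. {u, v} \<noteq> {x, y} \<longrightarrow>
        \<gamma> u v ` {0<..<1} \<inter> path_image (\<gamma> x y) = {})"

definition planar :: "'a pair_pre_digraph \<Rightarrow> bool" where
  "planar G \<longleftrightarrow> (\<exists>pos \<gamma>. plane_drawing G pos \<gamma>)"

definition coloring :: "'a pair_pre_digraph \<Rightarrow> ('a \<Rightarrow> nat) \<Rightarrow> bool" where
  "coloring G f \<longleftrightarrow> (\<forall>v \<in> pverts G. f v > 0) \<and> (\<forall>(v, w) \<in> parcs G. f v \<noteq> f w)"

definition odd_sum_coloring :: "'a pair_pre_digraph \<Rightarrow> ('a \<Rightarrow> nat) \<Rightarrow> bool" where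
  "odd_sum_coloring G f \<longleftrightarrow>
     coloring G f \<and> (\<forall>v \<in> pverts G. odd (\<Sum>w \<in> closed_nbhd G v. f w))"

text \<open>Colorings are total functions here, so the range of \<open>f\<close> is its image of the vertex set.\<close>

definition odd_sum_chromatic_number :: "'a pair_pre_digraph \<Rightarrow> nat" where
  "odd_sum_chromatic_number G = (LEAST k. \<exists>f. odd_sum_coloring G f \<and> card (f ` pverts G) = k)"

end

theory Submission
  imports Defs
begin

text \<open>
  In an odd-sum coloring \<open>f\<close> the parities of the colors solve a linear system over the field with two
  elements: the odd-colored vertices form a set that meets every closed neighborhood in an odd
  number of vertices. Odd colors and even colors are distinct, so a graph on which this system
  forces four pairwise adjacent vertices to be odd and four pairwise adjacent vertices to be even
  needs eight colors. In a planar graph each parity class can be colored with four colors, so eight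
  is the most that this argument can give when the parities are forced.

  The graph below consists of two parts, joined by the two edges \<open>5-6\<close> and \<open>12-0\<close>. The first is a
  complete graph on \<open>0, 2, 3, 5\<close> together with a vertex \<open>1\<close> of degree two on top of the edge \<open>0-2\<close>
  and a vertex \<open>4\<close> of degree two on top of \<open>3-5\<close>. The second is a complete graph on \<open>6, 7, 11, 12\<close>
  and a triangle on \<open>8, 9, 10\<close>, joined to it by \<open>7-8\<close> and \<open>10-11\<close>. Each of the vertices of degree two
  (\<open>1\<close>, \<open>4\<close> and \<open>9\<close>) has a closed neighborhood contained in larger ones, so many of the equations can be
  subtracted from each other, and the system collapses: the first complete graph must be odd and
  the second one even (\<open>odd_sum_coloring_parity\<close>). A coloring with eight colors is written down
  explicitly.

  The vertices are numbered along a Hamiltonian cycle. A Hamiltonian graph stays connected when a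
  vertex is deleted, which gives 2-connectedness (\<open>Hamiltonian_imp_2_connected\<close>). Planarity is
  shown by a straight-line drawing on the integer lattice: for any two edges, one of the lines
  that carry them separates them (\<open>planar_straight_line\<close>), which is a computation with the signs
  of integer determinants.
\<close>

section \<open>Straight-line drawings\<close>

text \<open>
  Twice the signed area of the triangle \<open>a b c\<close>. Its sign tells on which side of the line through \<open>a\<close>
  and \<open>b\<close> the point \<open>c\<close> lies, and it vanishes when the three points are collinear.
\<close>

definition orient :: "complex \<Rightarrow> complex \<Rightarrow> complex \<Rightarrow> real" where
  "orient a b c = Im (cnj (b - a) * (c - a))"

text \<open>
  A test for the segment \<open>a b\<close> without its ends to miss the whole segment \<open>c d\<close>. Either \<open>c\<close> and \<open>d\<close>
  lie strictly on one side of the line \<open>a b\<close>, or the line \<open>c d\<close> has \<open>a\<close> and \<open>b\<close> weakly on one side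
  but not both on it. The weak second alternative covers two edges with a common end. The
  orientation function is a parameter, so that the test can be evaluated in the integers and
  then transferred to the complex plane.
\<close>

definition separated :: "('p \<Rightarrow> 'p \<Rightarrow> 'p \<Rightarrow> 'r::linordered_idom) \<Rightarrow> 'p \<Rightarrow> 'p \<Rightarrow> 'p \<Rightarrow> 'p \<Rightarrow> bool"
  where
  "separated ori a b c d \<longleftrightarrow>
     ori a b c * ori a b d > 0 \<or>
     (ori c d a * ori c d b \<ge> 0 \<and> (ori c d a \<noteq> 0 \<or> ori c d b \<noteq> 0))"

lemma orient_convex_comb:
  "orient a b ((1 - t) *\<^sub>R c + t *\<^sub>R d) = (1 - t) * orient a b c + t * orient a b d"
  by (simp add: orient_def algebra_simps)

lemma orient_ends [simp]: "orient a b a = 0" "orient a b b = 0"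
  by (simp_all add: orient_def algebra_simps)

text \<open>
  Along a segment \<open>orient\<close> is an affine function of the parameter. At a common point of the two
  segments it would vanish both for the line \<open>a b\<close> and for the line \<open>c d\<close>, but an affine function
  whose end values have the same strict sign has no zero, and one whose end values are not both
  zero and weakly of the same sign has none in the interior.
\<close>

lemma separated_disjoint:
  assumes "separated orient a b c d"
  shows "linepath a b ` {0<..<1} \<inter> closed_segment c d = {}"
proof (rule ccontr)
  assume "linepath a b ` {0<..<1} \<inter> closed_segment c d \<noteq> {}"
  then obtain s t where s: "0 < s" "s < 1" and t: "0 \<le> t" "t \<le> 1"
    and eq: "(1 - s) *\<^sub>R a + s *\<^sub>R b = (1 - t) *\<^sub>R c + t *\<^sub>R d"
    by (auto simp: linepath_def in_segment)
  have ab: "(1 - t) * orient a b c + t * orient a b d = 0"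
    using orient_convex_comb[of a b t c d] orient_convex_comb[of a b s a b] eq by simp
  have cd: "(1 - s) * orient c d a + s * orient c d b = 0"
    using orient_convex_comb[of c d s a b] orient_convex_comb[of c d t c d] eq by simp
  have strict: False if "x * y > 0" "(1 - r) * x + r * y = 0" "0 \<le> r" "r \<le> 1" for x y r :: real
  proof -
    have "(1 - r) * (x * x) + r * (x * y) = x * ((1 - r) * x + r * y)"
      by (simp add: algebra_simps)
    also have "\<dots> = 0" using that by simp
    finally have sum0: "(1 - r) * (x * x) + r * (x * y) = 0" .
    have "x \<noteq> 0" using that(1) by auto
    then have "x * x > 0" by (simp add: zero_less_mult_iff linorder_neq_iff disj_commute)
    then have "(1 - r) * (x * x) \<ge> 0" "r * (x * y) \<ge> 0"
      using that by (auto intro!: mult_nonneg_nonneg)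
    with sum0 have "(1 - r) * (x * x) = 0" "r * (x * y) = 0" by linarith+
    then show False using \<open>x * x > 0\<close> \<open>x * y > 0\<close> by auto
  qed
  from assms consider "orient a b c * orient a b d > 0"
    | "orient c d a * orient c d b > 0"
    | "orient c d a = 0" "orient c d b \<noteq> 0"
    | "orient c d a \<noteq> 0" "orient c d b = 0"
    unfolding separated_def le_less by (metis mult_eq_0_iff)
  then show False
  proof cases
    case 1
    then show False using strict ab t by blast
  next
    case 2
    then show False using strict[OF 2 cd] s by linarith
  next
    case 3
    then show False using cd s by simp
  next
    case 4
    then show False using cd s by simp
  qed
qed

fun lattice_point :: "int \<times> int \<Rightarrow> complex" where
  "lattice_point (x, y) = Complex (of_int x) (of_int y)"

fun orient_lattice :: "int \<times> int \<Rightarrow> int \<times> int \<Rightarrow> int \<times> int \<Rightarrow> int" where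
  "orient_lattice (a, b) (c, d) (e, f) = (c - a) * (f - b) - (d - b) * (e - a)"

lemma orient_lattice_point:
  "orient (lattice_point p) (lattice_point q) (lattice_point r) = of_int (orient_lattice p q r)"
  by (cases p; cases q; cases r) (simp add: orient_def algebra_simps)

lemma separated_lattice_point:
  "separated orient (lattice_point a) (lattice_point b) (lattice_point c) (lattice_point d) \<longleftrightarrow>
    separated orient_lattice a b c d"
  by (simp add: separated_def orient_lattice_point flip: of_int_mult)

lemma orient_lattice_swap: "orient_lattice b a c = - orient_lattice a b c"
  by (cases a; cases b; cases c) (simp add: algebra_simps)

lemma separated_lattice_swap:
  "separated orient_lattice b a c d = separated orient_lattice a b c d"
  "separated orient_lattice a b d c = separated orient_lattice a b c d"
  by (simp_all add: separated_def orient_lattice_swap[of b a] orient_lattice_swap[of d c] mult.commute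
      disj_commute)

text \<open>
  It suffices to compare edges with edges: every vertex \<open>w\<close> has two neighbors, so for any given edge
  \<open>u v\<close> there is a different edge at \<open>w\<close>, and the interior of \<open>u v\<close> misses all of that edge, its
  end \<open>w\<close> included.
\<close>

lemma planar_straight_line:
  assumes "pair_graph G" and inj: "inj_on pos (pverts G)"
    and deg: "\<And>w. w \<in> pverts G \<Longrightarrow> card (nbhd G w) \<ge> 2"
    and sep: "\<And>u v x y. (u, v) \<in> parcs G \<Longrightarrow> (x, y) \<in> parcs G \<Longrightarrow> {u, v} \<noteq> {x, y} \<Longrightarrow>
      separated orient (pos u) (pos v) (pos x) (pos y)"
  shows "planar G"
proof -
  interpret pair_graph G by fact
  define \<gamma> where "\<gamma> u v = linepath (pos u) (pos v)" for u v
  have disj: "\<gamma> u v ` {0<..<1} \<inter> path_image (\<gamma> x y) = {}"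
    if "(u, v) \<in> parcs G" "(x, y) \<in> parcs G" "{u, v} \<noteq> {x, y}" for u v x y
    unfolding \<gamma>_def path_image_linepath by (intro separated_disjoint sep that)
  have vertices: "\<gamma> u v ` {0<..<1} \<inter> pos ` pverts G = {}" if uv: "(u, v) \<in> parcs G" for u v
  proof (rule Int_emptyI)
    fix p assume p: "p \<in> \<gamma> u v ` {0<..<1}" and "p \<in> pos ` pverts G"
    then obtain w where w: "w \<in> pverts G" and p_def: "p = pos w" by blast
    have "\<not> card (nbhd G w) \<le> Suc 0" "finite (nbhd G w)"
      using deg[OF w] by (simp_all add: card_ge_0_finite)
    then obtain x y where xy: "x \<in> nbhd G w" "y \<in> nbhd G w" "x \<noteq> y"
      by (meson card_le_Suc0_iff_eq)
    obtain z where z: "(w, z) \<in> parcs G" "{u, v} \<noteq> {w, z}"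
    proof (cases "{u, v} = {w, x}")
      case True
      with xy have "{u, v} \<noteq> {w, y}" by (auto simp: doubleton_eq_iff)
      with xy show ?thesis by (intro that[of y]) (simp_all add: nbhd_def)
    next
      case False
      with xy show ?thesis by (intro that[of x]) (simp_all add: nbhd_def)
    qed
    have "p \<in> path_image (\<gamma> w z)" by (simp add: \<gamma>_def p_def)
    with p disj[OF uv z] show False by blast
  qed
  have "plane_drawing G pos \<gamma>"
    unfolding plane_drawing_def
  proof (intro conjI ballI; clarify?)
    show "inj_on pos (pverts G)" by (rule inj)
  next
    fix u v assume uv: "(u, v) \<in> parcs G"
    have "pos u \<noteq> pos v"
      using inj_on_eq_iff[OF inj in_arcsD1[OF uv] in_arcsD2[OF uv]] no_loops'[OF uv] by simp
    then show "Path_Connected.arc (\<gamma> u v) \<and> pathstart (\<gamma> u v) = pos u \<and>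
        pathfinish (\<gamma> u v) = pos v \<and> path_image (\<gamma> v u) = path_image (\<gamma> u v) \<and>
        \<gamma> u v ` {0<..<1} \<inter> pos ` pverts G = {}"
      using vertices[OF uv] by (simp add: \<gamma>_def closed_segment_commute)
  next
    fix u v x y assume "(u, v) \<in> parcs G" "(x, y) \<in> parcs G" "{u, v} \<noteq> {x, y}"
    then show "\<gamma> u v ` {0<..<1} \<inter> path_image (\<gamma> x y) = {}" by (rule disj)
  qed
  then show ?thesis unfolding planar_def by blast
qed

section \<open>Two-connectedness of Hamiltonian graphs\<close>

lemma connected_induced_walk:
  assumes G: "pair_graph G" and walk: "\<And>i. (c i, c (Suc i)) \<in> parcs G" and "a < b"
  shows "Digraph_Component.connected (with_proj G \<restriction> (c ` {a..<b}))"
proof -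
  interpret pair_graph G by fact
  let ?H = "with_proj G \<restriction> (c ` {a..<b})"
  let ?R = "rtrancl_on (c ` {a..<b}) ((arcs_ends ?H)\<^sup>s)"
  have edge: "(c i, c (Suc i)) \<in> (arcs_ends ?H)\<^sup>s" if "a \<le> i" "Suc i < b" for i
    using walk[of i] that by (auto simp: arcs_ends_def arc_to_ends_def symcl_def)
  have sym: "sym ?R"
    by (rule rtrancl_on_sym) (auto simp: symcl_def sym_def)
  have from_a: "(c a, c i) \<in> ?R" if "a \<le> i" "i < b" for i
    using that
  proof (induction i rule: dec_induct)
    case base
    then show ?case by (auto intro: rtrancl_on_refl)
  next
    case (step i)
    then show ?case using edge
      by (auto intro!: rtrancl_on_into_rtrancl_on[of "c a" "c i"])
  qed
  have "(u, v) \<in> ?R" if uv: "u \<in> c ` {a..<b}" "v \<in> c ` {a..<b}" for u v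
  proof -
    obtain i j where "u = c i" "v = c j" "a \<le> i" "i < b" "a \<le> j" "j < b"
      using uv by auto
    then show ?thesis
      using rtrancl_on_trans[OF symD[OF sym from_a[of i]] from_a[of j]] by simp
  qed
  then show ?thesis
    unfolding Digraph_Component.connected_conv using \<open>a < b\<close> by auto
qed

text \<open>
  What remains of a cycle \<open>c\<close> after deleting the vertex \<open>c k\<close> is the path from \<open>c (k + 1)\<close> to
  \<open>c (k + n - 1)\<close>. Indexing the cycle periodically by all natural numbers makes this an interval of
  indices, without a case distinction on where the path wraps around.
\<close>

lemma Hamiltonian_imp_2_connected:
  assumes G: "pair_graph G" and walk: "\<And>i. (c i, c (Suc i)) \<in> parcs G"
    and period: "\<And>i. c (i + n) = c i" and n: "n > 2"
    and bij: "bij_betw c {0..<n} (pverts G)"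
  shows "k_connected 2 G"
proof -
  have verts: "pverts G = c ` {0..<n}" using bij by (simp add: bij_betw_def)
  have card: "card (pverts G) = n" using bij_betw_same_card[OF bij] by simp
  have "Digraph_Component.connected (with_proj G \<restriction> (pverts G - X))"
    if X: "X \<subseteq> pverts G" "card X < 2" for X
  proof -
    have "finite X" using finite_subset[OF X(1)] verts by simp
    with X(2) consider "X = {}" | w where "X = {w}"
      by (auto simp: less_2_cases_iff card_1_singleton_iff)
    then show ?thesis
    proof cases
      case 1
      then show ?thesis
        using connected_induced_walk[where c = c and a = 0 and b = n, OF G walk] n by (simp add: verts)
    next
      case 2
      then obtain k where k: "k < n" "w = c k" using X verts by auto
      have inj: "c i = c j \<longleftrightarrow> i = j" if "i < n" "j < n" for i j
        using bij that by (auto simp: bij_betw_def inj_on_def)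
      have "c ` {Suc k..<k + n} = c ` {Suc k..<n} \<union> c ` {n..<k + n}"
        using k(1) by (auto simp flip: image_Un simp: ivl_disj_un_two(3))
      also have "c ` {n..<k + n} = (\<lambda>i. c (i + n)) ` {0..<k}"
        by (subst image_image[symmetric, of c "\<lambda>i. i + n"]) simp
      also have "\<dots> = c ` {0..<k}" by (simp add: period)
      also have "c ` {Suc k..<n} \<union> c ` {0..<k} = c ` ({0..<n} - {k})"
        using k(1) by (auto simp flip: image_Un intro!: arg_cong[where f = "(`) c"])
      also have "\<dots> = pverts G - X"
        using k inj by (auto simp: verts 2)
      finally show ?thesis
        using connected_induced_walk[where c = c and a = "Suc k" and b = "k + n", OF G walk] n by simp
    qed
  qed
  then show ?thesis unfolding k_connected_def using n card by simp
qed

section \<open>The graph\<close>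

lemma atLeastLessThan_13: "{0..<13::nat} = {0,1,2,3,4,5,6,7,8,9,10,11,12}"
  by (simp add: atLeastLessThanSuc insert_commute eval_nat_numeral)

definition edge_list :: "(nat \<times> nat) list" where
  "edge_list =
    \<comment> \<open>the Hamiltonian cycle, then the chords inside \<open>{0..5}\<close>, \<open>{6, 7, 11, 12}\<close> and \<open>{8, 9, 10}\<close>\<close>
    [(0,1), (1,2), (2,3), (3,4), (4,5), (5,6), (6,7), (7,8), (8,9), (9,10), (10,11), (11,12), (12,0),
     (0,2), (0,3), (0,5), (2,5), (3,5),
     (6,11), (6,12), (7,11), (7,12),
     (8,10)]"

definition twin_K4 :: "nat pair_pre_digraph" where
  "twin_K4 = \<lparr>pverts = {0..<13}, parcs = set edge_list \<union> (set edge_list)\<inverse>\<rparr>"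

lemma pverts_twin_K4: "pverts twin_K4 = {0,1,2,3,4,5,6,7,8,9,10,11,12}"
  by (auto simp: twin_K4_def atLeastLessThan_13)

lemma pair_graph_twin_K4: "pair_graph twin_K4"
proof unfold_locales
  show "symmetric (with_proj twin_K4)"
    by (simp add: symmetric_def twin_K4_def sym_Un_converse)
qed (auto simp: twin_K4_def edge_list_def)

text \<open>
  The vertex \<open>1\<close> appears as \<open>Suc 0\<close> on the left-hand side because that is the normal form of the
  simplifier, and the equations serve as rewrite rules.
\<close>

lemma nbhd_twin_K4:
  "nbhd twin_K4 0 = {1, 2, 3, 5, 12}"
  "nbhd twin_K4 (Suc 0) = {0, 2}"
  "nbhd twin_K4 2 = {0, 1, 3, 5}"
  "nbhd twin_K4 3 = {0, 2, 4, 5}"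
  "nbhd twin_K4 4 = {3, 5}"
  "nbhd twin_K4 5 = {0, 2, 3, 4, 6}"
  "nbhd twin_K4 6 = {5, 7, 11, 12}"
  "nbhd twin_K4 7 = {6, 8, 11, 12}"
  "nbhd twin_K4 8 = {7, 9, 10}"
  "nbhd twin_K4 9 = {8, 10}"
  "nbhd twin_K4 10 = {8, 9, 11}"
  "nbhd twin_K4 11 = {6, 7, 10, 12}"
  "nbhd twin_K4 12 = {0, 6, 7, 11}"
  by (auto simp: nbhd_def twin_K4_def edge_list_def)

lemma k_connected_twin_K4: "k_connected 2 twin_K4"
proof (rule Hamiltonian_imp_2_connected[where n = 13])
  show "pair_graph twin_K4" by (rule pair_graph_twin_K4)
  show "(i mod 13, Suc i mod 13) \<in> parcs twin_K4" for i
  proof -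
    define j where "j = i mod 13"
    have j: "j \<in> {0,1,2,3,4,5,6,7,8,9,10,11,12}"
      unfolding atLeastLessThan_13[symmetric] by (simp add: j_def)
    have "Suc i mod 13 = (if j = 12 then 0 else Suc j)"
      by (simp add: mod_Suc j_def)
    moreover have "(j, if j = 12 then 0 else Suc j) \<in> parcs twin_K4"
      using j by (auto simp: twin_K4_def edge_list_def)
    ultimately show ?thesis by (simp add: j_def)
  qed
  have "bij_betw (\<lambda>i. i mod 13) {0..<13} {0..<13::nat}"
    by (subst bij_betw_cong[of _ _ id]) simp_all
  then show "bij_betw (\<lambda>i. i mod 13) {0..<13} (pverts twin_K4)"
    by (simp add: twin_K4_def)
qed simp_all

text \<open>
  The first complete graph is drawn in the left half with outer triangle \<open>0, 3, 5\<close>, the second in the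
  right half with outer triangle \<open>6, 11, 12\<close>. The vertices \<open>2\<close> and \<open>7\<close> lie inside these triangles,
  and the triangle \<open>8, 9, 10\<close> lies in the face between \<open>6\<close>, \<open>7\<close> and \<open>11\<close>.
\<close>

definition coordinates :: "(int \<times> int) list" where
  "coordinates =
    [(6,0), (5,6), (4,5), (0,6), (2,11), (6,12),
     (8,12), (10,5), (12,8), (13,7), (14,8), (20,6), (8,0)]"

lemma separated_edges:
  "\<forall>(u, v) \<in> set edge_list. \<forall>(x, y) \<in> set edge_list. (u, v) \<noteq> (x, y) \<longrightarrow>
    separated orient_lattice (coordinates ! u) (coordinates ! v) (coordinates ! x) (coordinates ! y)"
  by code_simp

lemma planar_twin_K4: "planar twin_K4"
proof (rule planar_straight_line[where pos = "\<lambda>v. lattice_point (coordinates ! v)"])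
  show "pair_graph twin_K4" by (rule pair_graph_twin_K4)
  show "inj_on (\<lambda>v. lattice_point (coordinates ! v)) (pverts twin_K4)"
    by (simp add: pverts_twin_K4 coordinates_def complex_eq_iff)
  show "card (nbhd twin_K4 w) \<ge> 2" if "w \<in> pverts twin_K4" for w
    using that by (auto simp: pverts_twin_K4 nbhd_twin_K4)
  show "separated orient (lattice_point (coordinates ! u)) (lattice_point (coordinates ! v))
      (lattice_point (coordinates ! x)) (lattice_point (coordinates ! y))"
    if uv: "(u, v) \<in> parcs twin_K4" and xy: "(x, y) \<in> parcs twin_K4"
      and ne: "{u, v} \<noteq> {x, y}" for u v x y
  proof -
    let ?sep = "\<lambda>u v x y. separated orient_lattice (coordinates ! u) (coordinates ! v)
      (coordinates ! x) (coordinates ! y)"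
    have sep: "?sep a b c d"
      if "(a, b) \<in> set edge_list" "(c, d) \<in> set edge_list" "(a, b) \<noteq> (c, d)" for a b c d
      using bspec[OF separated_edges that(1)] that(2,3) by (auto simp only: split: prod.splits)
    have "(u, v) \<in> set edge_list \<or> (v, u) \<in> set edge_list"
      "(x, y) \<in> set edge_list \<or> (y, x) \<in> set edge_list"
      using uv xy by (simp_all add: twin_K4_def)
    then have "?sep u v x y"
    proof (elim disjE)
      assume "(u, v) \<in> set edge_list" "(x, y) \<in> set edge_list"
      with ne show ?thesis by (intro sep) auto
    next
      assume "(u, v) \<in> set edge_list" "(y, x) \<in> set edge_list"
      with ne have "?sep u v y x" by (intro sep) auto
      then show ?thesis by (simp add: separated_lattice_swap)
    next
      assume "(v, u) \<in> set edge_list" "(x, y) \<in> set edge_list"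
      with ne have "?sep v u x y" by (intro sep) auto
      then show ?thesis by (simp add: separated_lattice_swap)
    next
      assume "(v, u) \<in> set edge_list" "(y, x) \<in> set edge_list"
      with ne have "?sep v u y x" by (intro sep) auto
      then show ?thesis by (simp add: separated_lattice_swap)
    qed
    then show ?thesis by (simp add: separated_lattice_point)
  qed
qed

lemma max_degree_twin_K4: "max_degree twin_K4 = 5"
  by (simp add: max_degree_def pverts_twin_K4 nbhd_twin_K4)

section \<open>Odd-sum colorings\<close>

text \<open>
  Subtracting the condition at \<open>9\<close> from those at \<open>8\<close> and \<open>10\<close> makes \<open>7\<close> and \<open>11\<close> even. Subtracting the
  condition at \<open>3\<close> from that at \<open>5\<close> makes \<open>6\<close> even, and likewise \<open>2\<close> and \<open>0\<close> make \<open>12\<close> even. With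
  the second complete graph even, the conditions at \<open>6\<close> and \<open>12\<close> make its outside neighbors \<open>5\<close> and \<open>0\<close>
  odd. Finally, the conditions at \<open>3\<close> and \<open>4\<close> give \<open>2\<close> the parity of \<open>0\<close>, and those at \<open>2\<close> and \<open>1\<close>
  give \<open>3\<close> the parity of \<open>5\<close>.
\<close>

lemma odd_sum_coloring_parity:
  assumes "odd_sum_coloring twin_K4 f"
  shows "\<forall>v \<in> {0, 2, 3, 5}. odd (f v)" "\<forall>v \<in> {6, 7, 11, 12}. even (f v)"
proof -
  have closed: "odd (\<Sum>w \<in> insert v (nbhd twin_K4 v). f w)" if "v \<in> pverts twin_K4" for v
    using assms that by (simp add: odd_sum_coloring_def closed_nbhd_def)
  note sum_simps = pverts_twin_K4 nbhd_twin_K4 ac_simps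
  \<comment> \<open>The summands are grouped so that each difference of two conditions leaves a single group;
    expanding the parity of a sum would destroy this grouping.\<close>
  have N1: "odd (f 0 + f 1 + f 2)"
    using closed[of 1] by (simp add: sum_simps del: even_add odd_add)
  have N2: "odd (f 0 + f 1 + f 2 + (f 3 + f 5))"
    using closed[of 2] by (simp add: sum_simps del: even_add odd_add)
  have N0: "odd (f 0 + f 1 + f 2 + (f 3 + f 5) + f 12)"
    using closed[of 0] by (simp add: sum_simps del: even_add odd_add)
  have N4: "odd (f 3 + f 4 + f 5)"
    using closed[of 4] by (simp add: sum_simps del: even_add odd_add)
  have N3: "odd (f 3 + f 4 + f 5 + (f 0 + f 2))"
    using closed[of 3] by (simp add: sum_simps del: even_add odd_add)
  have N5: "odd (f 3 + f 4 + f 5 + (f 0 + f 2) + f 6)"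
    using closed[of 5] by (simp add: sum_simps del: even_add odd_add)
  have N9: "odd (f 8 + f 9 + f 10)"
    using closed[of 9] by (simp add: sum_simps del: even_add odd_add)
  have N8: "odd (f 8 + f 9 + f 10 + f 7)"
    using closed[of 8] by (simp add: sum_simps del: even_add odd_add)
  have N10: "odd (f 8 + f 9 + f 10 + f 11)"
    using closed[of 10] by (simp add: sum_simps del: even_add odd_add)
  have N6: "odd (f 6 + f 7 + f 11 + f 12 + f 5)"
    using closed[of 6] by (simp add: sum_simps del: even_add odd_add)
  have N12: "odd (f 6 + f 7 + f 11 + f 12 + f 0)"
    using closed[of 12] by (simp add: sum_simps del: even_add odd_add)
  have even: "even (f 6)" "even (f 7)" "even (f 11)" "even (f 12)"
    using N5 N3 N8 N9 N10 N0 N2 by (metis even_add)+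
  then have odd: "odd (f 0)" "odd (f 5)"
    using N6 N12 by simp_all
  have "even (f 0 + f 2)" "even (f 3 + f 5)"
    using N3 N4 N2 N1 by (metis even_add)+
  with odd have "odd (f 2)" "odd (f 3)"
    by simp_all
  with even odd show "\<forall>v \<in> {0, 2, 3, 5}. odd (f v)" "\<forall>v \<in> {6, 7, 11, 12}. even (f v)"
    by auto
qed

lemma odd_sum_coloring_at_least_8_colors:
  assumes f: "odd_sum_coloring twin_K4 f"
  shows "card (f ` pverts twin_K4) \<ge> 8"
proof -
  have proper: "f v \<noteq> f w" if "w \<in> nbhd twin_K4 v" for v w
    using f that by (auto simp: odd_sum_coloring_def coloring_def nbhd_def)
  have "inj_on f {0, 2, 3, 5}"
    using proper[of 2 0] proper[of 3 0] proper[of 5 0] proper[of 3 2] proper[of 5 2] proper[of 5 3]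
    by (auto simp: nbhd_twin_K4)
  moreover have "inj_on f {6, 7, 11, 12}"
    using proper[of 7 6] proper[of 11 6] proper[of 12 6] proper[of 11 7] proper[of 12 7]
      proper[of 12 11]
    by (auto simp: nbhd_twin_K4)
  ultimately have "card (f ` {0, 2, 3, 5}) = 4" "card (f ` {6, 7, 11, 12}) = 4"
    by (simp_all add: card_image)
  moreover have "f ` {0, 2, 3, 5} \<inter> f ` {6, 7, 11, 12} = {}"
    using odd_sum_coloring_parity[OF f] by auto
  ultimately have "card (f ` {0, 2, 3, 5} \<union> f ` {6, 7, 11, 12}) = 8"
    by (subst card_Un_disjoint) auto
  moreover have "card (f ` {0, 2, 3, 5} \<union> f ` {6, 7, 11, 12}) \<le> card (f ` pverts twin_K4)"
    by (rule card_mono) (auto simp: pverts_twin_K4)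
  ultimately show ?thesis by simp
qed

definition eight_coloring :: "nat \<Rightarrow> nat" where
  "eight_coloring v = [1, 5, 3, 5, 1, 7, 2, 4, 1, 3, 5, 6, 8] ! v"

lemma odd_sum_eight_coloring: "odd_sum_coloring twin_K4 eight_coloring"
proof -
  have "coloring twin_K4 eight_coloring"
    unfolding coloring_def pverts_twin_K4
    by (auto simp: twin_K4_def edge_list_def eight_coloring_def)
  then show ?thesis
    by (simp add: odd_sum_coloring_def pverts_twin_K4 closed_nbhd_def nbhd_twin_K4
        eight_coloring_def)
qed

lemma card_eight_coloring: "card (eight_coloring ` pverts twin_K4) = 8"
  by (simp add: pverts_twin_K4 eight_coloring_def card_insert_if)

lemma odd_sum_chromatic_number_twin_K4: "odd_sum_chromatic_number twin_K4 = 8"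
  unfolding odd_sum_chromatic_number_def
proof (rule Least_equality)
  show "\<exists>f. odd_sum_coloring twin_K4 f \<and> card (f ` pverts twin_K4) = 8"
    using odd_sum_eight_coloring card_eight_coloring by blast
  show "8 \<le> k" if "\<exists>f. odd_sum_coloring twin_K4 f \<and> card (f ` pverts twin_K4) = k" for k
    using that odd_sum_coloring_at_least_8_colors by blast
qed

theorem theorem3:
  shows "\<exists>G :: nat pair_pre_digraph.
    pair_graph G \<and> k_connected 2 G \<and> planar G \<and> max_degree G = 5 \<and>
    odd_sum_chromatic_number G = 8"
  using pair_graph_twin_K4 k_connected_twin_K4 planar_twin_K4 max_degree_twin_K4
    odd_sum_chromatic_number_twin_K4 by blast

end
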